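(* For every $t \in o(\log n)$, $\mathrm{ACA}(t) = \mathrm{ACA}(O(1))$.
   Context: A cellular automaton (CA) is $C=(Q,\delta,\Sigma)$ with finite state set $Q$, local rule $\delta\colon Q^3\to Q$, input alphabet $\Sigma\subseteq Q$, and an inactive state $q\in Q\setminus\Sigma$ with $\delta(z_1,z_2,z_3)=q$ iff $z_2=q$; the global map is $\Delta(c)(z)=\delta(c(z-1),c(z),c(z+1))$ on $Q^{\mathbb{Z}}$. For input $w\in\Sigma^+$ the initial configuration has $c_0(i)=w(i)$ for $0\le i<|w|$ and $q$ elsewhere. An ACA additionally has a nonempty set $A\subseteq Q\setminus\{q\}$ of accept states and accepts $w$ if some $\Delta^\tau(c_0)$ has all cells in $A\cup\{q\}$; the least such $\tau$ is the acceptance time. For $t\colon\mathbb{N}_+\to\mathbb{N}_0$, $\mathrm{ACA}(t)$ is the class of languages $L(C)$ of ACAs accepting every $w\in L(C)$ within $t(|w|)$ steps, and $\mathrm{ACA}(O(1))$ is the union of $\mathrm{ACA}(t)$ over constant functions $t$. Languages never contain the empty word.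
   Formalization: Equality for a single t is false (e.g. t = 0: {a} is in ACA(O(1)) but not in ACA(0)); what is proved is ACA(t) ⊆ ACA(O(1)) for every t in o(log n), and that the union of ACA(t) over all t in o(log n) equals ACA(O(1)). *)

theory Defs
  imports Complex_Main "HOL-Library.Landau_Symbols" "HOL-Library.Infinite_Typeclass"
begin

(* States are drawn from one fixed type 'a, so that a class of languages is a set and no
   quantification over types is needed.  If 'a is infinite, every finite CA over the given
   alphabet is, up to renaming of its non-input states, of this form. *)

record 'a aca =
  states   :: "'a set"
  rule     :: "'a \<Rightarrow> 'a \<Rightarrow> 'a \<Rightarrow> 'a"
  inputs   :: "'a set"
  inactive :: "'a"
  accept   :: "'a set"

definition is_ca :: "('a, 'b) aca_scheme \<Rightarrow> bool" where
  "is_ca C \<longleftrightarrow>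
     finite (states C) \<and>
     (\<forall>z1\<in>states C. \<forall>z2\<in>states C. \<forall>z3\<in>states C. rule C z1 z2 z3 \<in> states C) \<and>
     inputs C \<subseteq> states C \<and>
     inactive C \<in> states C - inputs C \<and>
     (\<forall>z1\<in>states C. \<forall>z2\<in>states C. \<forall>z3\<in>states C.
        rule C z1 z2 z3 = inactive C \<longleftrightarrow> z2 = inactive C)"

definition is_aca :: "('a, 'b) aca_scheme \<Rightarrow> bool" where
  "is_aca C \<longleftrightarrow> is_ca C \<and> accept C \<noteq> {} \<and> accept C \<subseteq> states C - {inactive C}"

definition global_map :: "('a, 'b) aca_scheme \<Rightarrow> (int \<Rightarrow> 'a) \<Rightarrow> int \<Rightarrow> 'a" where
  "global_map C c = (\<lambda>z. rule C (c (z - 1)) (c z) (c (z + 1)))"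

definition initial_config :: "('a, 'b) aca_scheme \<Rightarrow> 'a list \<Rightarrow> int \<Rightarrow> 'a" where
  "initial_config C w =
     (\<lambda>i. if 0 \<le> i \<and> i < int (length w) then w ! nat i else inactive C)"

definition accepts_at :: "('a, 'b) aca_scheme \<Rightarrow> 'a list \<Rightarrow> nat \<Rightarrow> bool" where
  "accepts_at C w \<tau> \<longleftrightarrow>
     (\<forall>z. (global_map C ^^ \<tau>) (initial_config C w) z \<in> accept C \<union> {inactive C})"

definition acceptance_time :: "('a, 'b) aca_scheme \<Rightarrow> 'a list \<Rightarrow> nat" where
  "acceptance_time C w = (LEAST \<tau>. accepts_at C w \<tau>)"

definition language :: "('a, 'b) aca_scheme \<Rightarrow> 'a list set" where
  "language C = {w \<in> lists (inputs C). w \<noteq> [] \<and> (\<exists>\<tau>. accepts_at C w \<tau>)}"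

(* Time bounds are functions on the positive integers; the value at 0 is never consulted,
   since languages do not contain the empty word. *)

definition ACA :: "(nat \<Rightarrow> nat) \<Rightarrow> 'a list set set" where
  "ACA t = {language C | C :: 'a aca.
     is_aca C \<and> (\<forall>w \<in> language C. acceptance_time C w \<le> t (length w))}"

definition ACA_class :: "(nat \<Rightarrow> nat) set \<Rightarrow> 'a list set set" where
  "ACA_class T = (\<Union>t\<in>T. ACA t)"

definition constant_bounds :: "(nat \<Rightarrow> nat) set" where
  "constant_bounds = {(\<lambda>_. k) | k. True}"

definition sublog_bounds :: "(nat \<Rightarrow> nat) set" where
  "sublog_bounds = {t. (\<lambda>n. real (t n)) \<in> o(\<lambda>n. ln (real n))}"

(* For an individual bound t in o(log n) the inclusion of ACA(O(1)) in ACA(t) is false: with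
   n so large that n > 2 t(n), an ACA accepting a^n after at most t(n) steps also accepts
   a^(n+1), because both words have the same neighbourhoods of that radius; hence the language
   {a^n}, which is in ACA(O(1)), is not in ACA(t).  The equality of a sublogarithmic class
   with ACA(O(1)) is therefore one between ACA_class sublog_bounds and
   ACA_class constant_bounds, together with the inclusion for each individual t. *)

end

theory Submission
  imports Defs "HOL-Real_Asymp.Real_Asymp"
begin

text \<open>
  Whether a word is accepted at time at most \<open>T\<close> depends only on the set of windows of radius \<open>T\<close>
  occurring in its initial configuration. There are at most \<open>N = |Q|^(2T+1)\<close> of them, and from a word
  longer than \<open>N (N + 1)\<close> a factor can be cut out without changing this set. So an acceptance time
  \<open>T\<close> that occurs at all occurs for a word of length \<open>|Q|^O(T)\<close>, and an automaton whose
  acceptance time is sublogarithmic already runs in constant time.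
\<close>

section \<open>Windows and the locality of acceptance\<close>

definition window :: "(int \<Rightarrow> 'a) \<Rightarrow> nat \<Rightarrow> int \<Rightarrow> 'a list" where
  "window c T z = map (\<lambda>m. c (z + m)) [- int T..int T]"

lemma window_eq_iff:
  "window c T z = window d T y \<longleftrightarrow> (\<forall>m. \<bar>m\<bar> \<le> int T \<longrightarrow> c (z + m) = d (y + m))"
  by (auto simp: window_def abs_le_iff)

lemma window_mono:
  assumes "window c T z = window d T y" "s \<le> T"
  shows "window c s z = window d s y"
  using assms by (auto simp: window_eq_iff)

text \<open>Each step reads one cell further to either side: the windows of radius \<open>s\<close>
  around a cell and its two neighbours all lie in the window of radius \<open>Suc s\<close> around
  that cell.\<close>

lemma global_map_funpow_window:
  assumes "window c s z = window d s y"
  shows "(global_map C ^^ s) c z = (global_map C ^^ s) d y"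
  using assms
proof (induction s arbitrary: z y)
  case 0
  then show ?case by (auto simp: window_eq_iff)
next
  case (Suc s)
  have shift: "window c s (z + k) = window d s (y + k)" if "\<bar>k\<bar> \<le> 1" for k
    unfolding window_eq_iff
  proof (intro allI impI)
    fix m :: int assume "\<bar>m\<bar> \<le> int s"
    then have "\<bar>k + m\<bar> \<le> int (Suc s)" using that by linarith
    then show "c (z + k + m) = d (y + k + m)"
      using Suc.prems by (simp add: window_eq_iff add.assoc)
  qed
  show ?case
    using Suc.IH[OF shift[of 0]] Suc.IH[OF shift[of 1]] Suc.IH[OF shift[of "-1"]]
    by (simp add: global_map_def)
qed

text \<open>Acceptance constrains each cell separately, so only the set of states present at time
  \<open>s\<close> matters, and each of these states is determined by a window. One inclusion
  between the sets of windows transfers acceptance in one direction.\<close>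

lemma accepts_at_cong_windows:
  assumes "range (window (initial_config C v) T) = range (window (initial_config C w) T)" "s \<le> T"
  shows "accepts_at C v s \<longleftrightarrow> accepts_at C w s"
proof -
  have imp: "accepts_at C b s"
    if "accepts_at C a s"
      and sub: "range (window (initial_config C b) T) \<subseteq> range (window (initial_config C a) T)" for a b
    unfolding accepts_at_def
  proof
    fix z
    obtain y where "window (initial_config C b) T z = window (initial_config C a) T y"
      using sub by blast
    then have "(global_map C ^^ s) (initial_config C b) z = (global_map C ^^ s) (initial_config C a) y"
      by (intro global_map_funpow_window window_mono[OF _ \<open>s \<le> T\<close>])
    then show "(global_map C ^^ s) (initial_config C b) z \<in> accept C \<union> {inactive C}"
      using that(1) by (simp add: accepts_at_def)
  qed
  show ?thesis using imp[of v w] imp[of w v] assms(1) by auto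
qed

text \<open>Windows of radius \<open>acceptance_time C w\<close> also determine acceptance at all
  earlier times, so \<open>v\<close> cannot be accepted sooner than \<open>w\<close>.\<close>

lemma acceptance_time_eqI:
  assumes "w \<in> language C" "v \<noteq> []" "set v \<subseteq> inputs C"
    and "range (window (initial_config C v) (acceptance_time C w)) =
         range (window (initial_config C w) (acceptance_time C w))"
  shows "v \<in> language C" "acceptance_time C v = acceptance_time C w"
proof -
  let ?T = "acceptance_time C w"
  have w: "accepts_at C w ?T"
    using assms(1) LeastI_ex[of "accepts_at C w"] by (auto simp: language_def acceptance_time_def)
  have v: "accepts_at C v ?T"
    using w accepts_at_cong_windows[OF assms(4)] by simp
  then show "v \<in> language C" using assms(2,3) by (auto simp: language_def)
  show "acceptance_time C v = ?T"
    unfolding acceptance_time_def[of C v]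
  proof (rule Least_equality)
    show "accepts_at C v ?T" by (rule v)
  next
    fix s assume s: "accepts_at C v s"
    show "?T \<le> s"
    proof (rule ccontr)
      assume "\<not> ?T \<le> s"
      then have "accepts_at C w s" using s accepts_at_cong_windows[OF assms(4), of s] by simp
      then show False using \<open>\<not> ?T \<le> s\<close> by (simp add: acceptance_time_def Least_le)
    qed
  qed
qed

section \<open>Removing a factor between equal windows\<close>

definition cut :: "(int \<Rightarrow> 'a) \<Rightarrow> int \<Rightarrow> int \<Rightarrow> int \<Rightarrow> 'a" where
  "cut c i j z = (if z < i then c z else c (z + (j - i)))"

text \<open>A window reaching across the seam at \<open>i\<close> meets cells at distance at most
  \<open>T\<close> from it. There, equality of the windows at \<open>i\<close> and \<open>j\<close>
  makes the kept and the removed cells agree.\<close>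

lemma window_cut:
  assumes eq: "window c T i = window c T j"
  shows "z \<le> i \<Longrightarrow> window (cut c i j) T z = window c T z"
    and "i \<le> z \<Longrightarrow> window (cut c i j) T z = window c T (z + (j - i))"
proof -
  have c: "c (i + m) = c (j + m)" if "\<bar>m\<bar> \<le> int T" for m
    using eq that by (simp add: window_eq_iff)
  show "window (cut c i j) T z = window c T z" if "z \<le> i"
    unfolding window_eq_iff cut_def using that c[of "z + _ - i"] by (auto simp: algebra_simps)
  show "window (cut c i j) T z = window c T (z + (j - i))" if "i \<le> z"
    unfolding window_eq_iff cut_def using that c[of "z + _ - i"] by (auto simp: algebra_simps)
qed

text \<open>Only windows centred strictly between \<open>i\<close> and \<open>j\<close> could get
  lost; \<open>old\<close> provides a copy of each with centre at or left of \<open>i\<close>, where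
  the cut changes no window.\<close>

lemma range_window_cut:
  assumes eq: "window c T i = window c T j" and "i \<le> j"
    and old: "\<And>k. i < k \<Longrightarrow> k < j \<Longrightarrow> \<exists>k'\<le>i. window c T k' = window c T k"
  shows "range (window (cut c i j) T) = range (window c T)"
proof (intro equalityI subsetI)
  fix x assume "x \<in> range (window (cut c i j) T)"
  then obtain z where "x = window (cut c i j) T z" by blast
  then show "x \<in> range (window c T)"
    using window_cut[OF eq, of z] by (cases "z \<le> i") auto
next
  fix x assume "x \<in> range (window c T)"
  then obtain k where k: "x = window c T k" by blast
  have low: "window c T z \<in> range (window (cut c i j) T)" if "z \<le> i" for z
    using window_cut(1)[OF eq that] by (metis rangeI)
  consider "k \<le> i" | "i < k" "k < j" | "j \<le> k" by linarith
  then show "x \<in> range (window (cut c i j) T)"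
  proof cases
    case 1
    then show ?thesis using low k by simp
  next
    case 2
    then obtain k' where "k' \<le> i" "window c T k' = window c T k" using old by blast
    then show ?thesis using low[of k'] k by simp
  next
    case 3
    then have "window (cut c i j) T (k - (j - i)) = window c T k"
      using window_cut(2)[OF eq, of "k - (j - i)"] by simp
    then show ?thesis using k by (metis rangeI)
  qed
qed

lemma initial_config_cut:
  assumes "i \<le> j" "j \<le> length w"
  shows "initial_config C (take i w @ drop j w) = cut (initial_config C w) (int i) (int j)"
proof
  fix z
  show "initial_config C (take i w @ drop j w) z = cut (initial_config C w) (int i) (int j) z"
  proof (cases "0 \<le> z")
    case True
    then obtain k where "z = int k" using nonneg_int_cases by blast
    then show ?thesis
      using assms by (auto simp: initial_config_def cut_def nth_append nat_add_distrib nat_diff_distrib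
          intro!: arg_cong[of _ _ "(!) w"])
  next
    case False
    then show ?thesis using assms by (auto simp: initial_config_def cut_def)
  qed
qed

text \<open>
  Two positions with the same value of \<open>f\<close> and the same number of first occurrences up to them have
  no first occurrence in between; there are only \<open>N (N + 1)\<close> such pairs of data.
\<close>

lemma repetition_without_new_value:
  fixes f :: "nat \<Rightarrow> 'b"
  assumes "f ` {..<n} \<subseteq> X" "finite X" "card X * (card X + 1) < n"
  shows "\<exists>i j. i < j \<and> j < n \<and> f i = f j \<and> (\<forall>k. i < k \<longrightarrow> k < j \<longrightarrow> (\<exists>k'\<le>i. f k' = f k))"
proof -
  define F where "F = {p. p < n \<and> (\<forall>p'<p. f p' \<noteq> f p)}"
  have "finite F" by (simp add: F_def)
  have "inj_on f F"
    by (rule inj_onI) (metis (mono_tags, lifting) F_def linorder_neqE_nat mem_Collect_eq)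
  moreover have "f ` F \<subseteq> X" using assms(1) by (auto simp: F_def)
  ultimately have "card F \<le> card X" using assms(2) by (metis card_inj_on_le)
  define g where "g p = (f p, card (F \<inter> {..p}))" for p
  have "card (F \<inter> {..p}) \<le> card X" for p
    using \<open>card F \<le> card X\<close> card_mono[OF \<open>finite F\<close>, of "F \<inter> {..p}"] by simp
  then have "g ` {..<n} \<subseteq> X \<times> {..card X}"
    using assms(1) by (auto simp: g_def)
  then have "card (g ` {..<n}) \<le> card X * (card X + 1)"
    using card_mono[of "X \<times> {..card X}" "g ` {..<n}"] assms(2) by (simp add: card_cartesian_product)
  then have "\<not> inj_on g {..<n}"
    using assms(3) by (auto dest: card_image)
  then obtain i j where ij: "i < j" "j < n" "g i = g j"
    unfolding inj_on_def by (metis lessThan_iff linorder_neqE_nat)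
  \<comment> \<open>One set contains the other and their cardinalities agree, so no first occurrence
    lies after \<open>i\<close> and up to \<open>j\<close>.\<close>
  have "F \<inter> {..i} = F \<inter> {..j}"
    using ij by (intro card_subset_eq) (auto simp: g_def \<open>finite F\<close>)
  have "\<exists>k'\<le>i. f k' = f k" if "i < k" "k < j" for k
  proof -
    define p where "p = (LEAST p. f p = f k)"
    have p: "f p = f k" "p \<le> k" "\<And>q. q < p \<Longrightarrow> f q \<noteq> f k"
      unfolding p_def by (rule LeastI, rule refl) (auto intro: Least_le dest: not_less_Least)
    then have "p \<in> F \<inter> {..j}" using that ij by (auto simp: F_def)
    then have "p \<le> i" using \<open>F \<inter> {..i} = F \<inter> {..j}\<close> by blast
    then show ?thesis using p by blast
  qed
  then show ?thesis using ij by (auto simp: g_def)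
qed

section \<open>Short words with a given acceptance time\<close>

lemma initial_config_in_states:
  assumes "is_aca C" "set w \<subseteq> inputs C"
  shows "initial_config C w z \<in> states C"
proof -
  have "w ! k \<in> states C" if "k < length w" for k
  proof -
    have "inputs C \<subseteq> states C" using assms(1) by (simp add: is_aca_def is_ca_def)
    then show ?thesis using assms(2) nth_mem[OF that] by blast
  qed
  then show ?thesis using assms(1) by (auto simp: initial_config_def is_aca_def is_ca_def)
qed

text \<open>\<open>N\<close> is the number of words of length \<open>2 * T + 1\<close> over the
  states, hence bounds the number of windows. While the word is too long, a cut shortens it and
  keeps its acceptance time.\<close>

lemma exists_short_word_with_acceptance_time:
  assumes "is_aca C" "w \<in> language C" "acceptance_time C w = T"
  defines "N \<equiv> card (states C) ^ (2 * T + 1)"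
  shows "\<exists>v\<in>language C. acceptance_time C v = T \<and> length v \<le> N * (N + 1)"
  using assms(2,3)
proof (induction w rule: measure_induct_rule[of length])
  case (less w)
  show ?case
  proof (cases "length w \<le> N * (N + 1)")
    case True
    then show ?thesis using less.prems by blast
  next
    case False
    let ?c = "initial_config C w"
    let ?X = "{xs. set xs \<subseteq> states C \<and> length xs = 2 * T + 1}"
    have fin: "finite (states C)" using assms(1) by (simp add: is_aca_def is_ca_def)
    have w: "set w \<subseteq> inputs C" using less.prems(1) by (auto simp: language_def)
    have "finite ?X" "card ?X = N"
      using finite_lists_length_eq[OF fin] card_lists_length_eq[OF fin] by (auto simp: N_def)
    moreover have "(\<lambda>p. window ?c T (int p)) ` {..<length w} \<subseteq> ?X"
      using initial_config_in_states[OF assms(1) w] by (auto simp: window_def)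
    ultimately obtain i j where ij: "i < j" "j < length w"
        "window ?c T (int i) = window ?c T (int j)"
      and old: "\<And>k. i < k \<Longrightarrow> k < j \<Longrightarrow> \<exists>k'\<le>i. window ?c T (int k') = window ?c T (int k)"
      using repetition_without_new_value[of "\<lambda>p. window ?c T (int p)" "length w" ?X] False
      by (auto simp: not_le)
    let ?v = "take i w @ drop j w"
    have "\<exists>k'\<le>int i. window ?c T k' = window ?c T k" if "int i < k" "k < int j" for k
    proof -
      have "i < nat k" "nat k < j" "int (nat k) = k" using that by linarith+
      then show ?thesis using old[of "nat k"] by (metis of_nat_le_iff)
    qed
    then have "range (window (initial_config C ?v) T) = range (window ?c T)"
      using ij by (simp add: initial_config_cut range_window_cut)
    \<comment> \<open>Since \<open>j < length w\<close> is strict, \<open>drop j w\<close> retains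
      the last letter.\<close>
    moreover have "set ?v \<subseteq> inputs C" "?v \<noteq> []"
      using w ij set_take_subset[of i w] set_drop_subset[of j w] by auto
    ultimately have "?v \<in> language C" "acceptance_time C ?v = T"
      using acceptance_time_eqI[OF less.prems(1), of ?v] less.prems(2) by simp_all
    moreover have "length ?v < length w" using ij by simp
    ultimately show ?thesis using less.IH by blast
  qed
qed

section \<open>From sublogarithmic to constant time\<close>

lemma acceptance_time_bounded:
  assumes C: "is_aca C" and t: "t \<in> sublog_bounds"
    and le: "\<forall>w\<in>language C. acceptance_time C w \<le> t (length w)"
  shows "\<exists>k. \<forall>w\<in>language C. acceptance_time C w \<le> k"
proof -
  define q where "q = card (states C)"
  have fin: "finite (states C)" using C by (simp add: is_aca_def is_ca_def)
  have "accept C \<noteq> {}" "accept C \<subseteq> states C - {inactive C}" "inactive C \<in> states C"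
    using C by (simp_all add: is_aca_def is_ca_def)
  then obtain a where "{a, inactive C} \<subseteq> states C" "a \<noteq> inactive C" by blast
  then have q: "q \<ge> 2" unfolding q_def using card_mono[OF fin, of "{a, inactive C}"] by simp
  \<comment> \<open>The 7 comes from \<open>N * (N + 1)\<close> being at most
    \<open>q ^ (4 * T + 3)\<close>, which is at most \<open>q ^ (7 * T)\<close> once
    \<open>T\<close> is positive.\<close>
  define K where "K = 7 * ln (real q)"
  have K: "K > 0" using q by (simp add: K_def)
  \<comment> \<open>The factor 2 leaves room for a contradiction: the short word gives
    \<open>ln (length v)\<close> at most \<open>K * T\<close>, whence \<open>T\<close> would be at
    most \<open>T / 2\<close>.\<close>
  have "eventually (\<lambda>n. norm (real (t n)) \<le> 1 / (2 * K) * norm (ln (real n))) sequentially"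
    using t K by (intro landau_o.smallD) (auto simp: sublog_bounds_def)
  then obtain n0 where n0: "\<And>n. n \<ge> n0 \<Longrightarrow> real (t n) \<le> 1 / (2 * K) * \<bar>ln (real n)\<bar>"
    by (auto simp: eventually_sequentially)
  \<comment> \<open>The length of \<open>w\<close> is arbitrary, but its acceptance time is shared
    by a short word \<open>v\<close>. Unless that time is 0, \<open>v\<close> has length at most
    \<open>n0\<close>, so finitely many values of \<open>t\<close> suffice.\<close>
  have "acceptance_time C w \<le> Max (t ` {..n0})" if w: "w \<in> language C" for w
  proof -
    define T where "T = acceptance_time C w"
    define N where "N = q ^ (2 * T + 1)"
    obtain v where v: "v \<in> language C" "acceptance_time C v = T" "length v \<le> N * (N + 1)"
      using exists_short_word_with_acceptance_time[OF C w T_def[symmetric]]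
      unfolding N_def q_def by blast
    have Tt: "T \<le> t (length v)" using le v by auto
    show ?thesis
    proof (cases "T = 0 \<or> length v \<le> n0")
      case True
      then show ?thesis
      proof
        assume "length v \<le> n0"
        then have "t (length v) \<le> Max (t ` {..n0})" by (intro Max_ge) auto
        then show ?thesis using Tt T_def by simp
      qed (simp add: T_def)
    next
      case False
      have "N \<ge> 1" using q by (simp add: N_def)
      moreover have "2 * N \<le> q * N" by (intro mult_right_mono q) simp
      ultimately have "N + 1 \<le> q * N" by linarith
      then have "N * (N + 1) \<le> N * (q * N)" by (intro mult_left_mono) simp_all
      also have "\<dots> = q ^ (4 * T + 3)"
        by (simp add: N_def power_add[symmetric] power_Suc[symmetric] numeral_3_eq_3 del: power_Suc)
      also have "\<dots> \<le> q ^ (7 * T)"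
        using q False by (intro power_increasing) auto
      finally have "real (length v) \<le> real q ^ (7 * T)"
        using v(3) by (metis of_nat_le_iff of_nat_power order_trans)
      moreover have "length v > 0" using v(1) by (auto simp: language_def)
      ultimately have "ln (real (length v)) \<le> ln (real q ^ (7 * T))"
        by (subst ln_le_cancel_iff) (use q in auto)
      also have "\<dots> = K * T" using q by (simp add: ln_realpow K_def)
      finally have "\<bar>ln (real (length v))\<bar> \<le> K * T"
        using \<open>length v > 0\<close> ln_ge_zero[of "real (length v)"] by linarith
      then have "1 / (2 * K) * \<bar>ln (real (length v))\<bar> \<le> 1 / (2 * K) * (K * T)"
        using K by (intro mult_left_mono) auto
      also have "\<dots> = T / 2" using K by simp
      finally have "real T \<le> T / 2"
        using n0[of "length v"] Tt False by linarith
      then show ?thesis using False by simp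
    qed
  qed
  then show ?thesis by blast
qed

lemma constant_bounds_subset_sublog_bounds: "constant_bounds \<subseteq> sublog_bounds"
proof -
  have "(\<lambda>_. real k) \<in> o(\<lambda>n. ln (real n))" for k by real_asymp
  then show ?thesis by (auto simp: constant_bounds_def sublog_bounds_def)
qed

theorem theorem6:
  shows "(\<forall>t \<in> sublog_bounds. (ACA t :: 'a :: infinite list set set) \<subseteq> ACA_class constant_bounds)
       \<and> (ACA_class sublog_bounds :: 'a list set set) = ACA_class constant_bounds"
proof -
  have sub: "(ACA t :: 'a list set set) \<subseteq> ACA_class constant_bounds" if "t \<in> sublog_bounds" for t
  proof
    fix L :: "'a list set" assume "L \<in> ACA t"
    then obtain C :: "'a aca" where C: "L = language C" "is_aca C"
        "\<forall>w\<in>language C. acceptance_time C w \<le> t (length w)"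
      by (auto simp: ACA_def)
    then obtain k where "\<forall>w\<in>language C. acceptance_time C w \<le> k"
      using acceptance_time_bounded \<open>t \<in> sublog_bounds\<close> by blast
    \<comment> \<open>The automaton stays the same; only the bound on its time is replaced.\<close>
    then have "L \<in> ACA (\<lambda>_. k)" using C by (auto simp: ACA_def)
    then show "L \<in> ACA_class constant_bounds" by (auto simp: ACA_class_def constant_bounds_def)
  qed
  moreover have "(ACA_class constant_bounds :: 'a list set set) \<subseteq> ACA_class sublog_bounds"
    using constant_bounds_subset_sublog_bounds by (auto simp: ACA_class_def)
  ultimately show ?thesis by (auto simp: ACA_class_def)
qed

end
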